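(* If an equational nominal unification problem $P$ is solvable, then the higher-order pattern unification problem $[P]$ is also solvable.
   Context: Nominal setting. Nominal terms $t::=f(t_1,\dots,t_n)\mid a\mid a.t\mid\pi\cdot X$ over atoms $a$ (of sorts of atoms), variables $X$, function symbols $f$, and permutations $\pi$ (finite sequences of swappings $(a\,b)$ of same-sort atoms, acting on atoms and homomorphically on terms, with $(a\,b)\cdot(c.t)=((a\,b)\cdot c).((a\,b)\cdot t)$, $\pi\cdot(\pi'\cdot X)=(\pi\pi')\cdot X$). Substitutions replace variables without renaming, with $\sigma(\pi\cdot X)=\pi\cdot\sigma(X)$. A freshness environment $\nabla$ is a finite set of constraints $a\#X$; $\nabla\vdash a\#t$ and $\nabla\vdash t\approx u$ are the least relations closed under: $\nabla\vdash a\#a'$ if $a\ne a'$; $\nabla\vdash a\#\pi\cdot X$ if $(\pi^{-1}\cdot a)\#X\in\nabla$; $\nabla\vdash a\#f(\vec t)$ if all $\nabla\vdash a\#t_i$; $\nabla\vdash a\#a.t$; $\nabla\vdash a\#a'.t$ if $a\ne a'$, $\nabla\vdash a\#t$; $\nabla\vdash a\approx a$; $\nabla\vdash\pi\cdot X\approx\pi'\cdot X$ if $a\#X\in\nabla$ whenever $\pi\cdot a\ne\pi'\cdot a$; $\nabla\vdash f(\vec t)\approx f(\vec t')$ if all $\nabla\vdash t_i\approx t_i'$; $\nabla\vdash a.t\approx a.t'$ if $\nabla\vdash t\approx t'$; $\nabla\vdash a.t\approx a'.t'$ if $a\ne a'$, $\nabla\vdash t\approx(a\,a')\cdot t'$,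 $\nabla\vdash a\#t'$. An equational nominal unification problem $P$ is a finite set of equations $t\stackrel{?}{\approx}u$; it is solvable if some $\langle\nabla,\sigma\rangle$ satisfies $\nabla\vdash\sigma(t)\approx\sigma(u)$ for all equations. Translation: let $\langle a_1,\dots,a_n\rangle$ be an ordered list of the distinct atoms occurring in $P$. Base types named by sorts; $[\nu]=\nu$, $[\delta]=\delta$, $[\langle\nu\rangle\tau]=\nu\to[\tau]$, $[\tau_1\times\cdots\times\tau_n\to\tau]=[\tau_1]\to\cdots\to[\tau_n]\to[\tau]$; atoms become $\lambda$-variables of the same name, function symbols constants. $[a]_\emptyset=a$, $[f(t_1,\dots,t_n)]_\emptyset=f([t_1]_\emptyset,\dots)$, $[a.t]_\emptyset=\lambda a.[t]_\emptyset$, $[\pi\cdot X]_\emptyset=X([\pi\cdot a_1]_\emptyset,\dots,[\pi\cdot a_n]_\emptyset)$ with $X$ a free $\lambda$-variable of type $[\nu_1]\to\cdots\to[\nu_n]\to[\tau]$ ($a_i:\nu_i$, $X:\tau$). $[P]=\{\lambda a_1.\cdots\lambda a_n.[t]_\emptyset\stackrel{?}{=}\lambda a_1.\cdots\lambda a_n.[u]_\emptyset\mid t\stackrel{?}{\approx}u\in P\}$, a higher-order pattern unification problem; it is solvable if some substitution $\theta$ satisfies $\theta(s)=\theta(s')$ modulo $\alpha\beta\eta$ for all its equations. *)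

theory Defs
  imports Main "HOL-Combinatorics.Transposition"
begin

text \<open>
  Type parameters: \<open>'n\<close> sorts of atoms, \<open>'d\<close> sorts of data, \<open>'f\<close> function symbols.
  Atoms and variables carry their sort; the arities of the function symbols are given by a
  parameter \<open>ar\<close>.
\<close>

section \<open>Nominal terms\<close>

datatype ('n, 'd) nty =
    NAtomSort 'n
  | NDataSort 'd
  | NAbs 'n "('n, 'd) nty"

datatype 'n atom = Atom (atom_sort: 'n) (atom_index: nat)

datatype ('n, 'd) unk = Unk (unk_sort: "('n, 'd) nty") (unk_index: nat)

type_synonym ('n, 'd, 'f) arity = "'f \<Rightarrow> ('n, 'd) nty list \<times> ('n, 'd) nty"

type_synonym 'n perm = "('n atom \<times> 'n atom) list"

datatype ('n, 'd, 'f) nterm =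
    NFun 'f "('n, 'd, 'f) nterm list"
  | NAtom "'n atom"
  | NAbst "'n atom" "('n, 'd, 'f) nterm"
  | NSusp "'n perm" "('n, 'd) unk"

definition wf_perm :: "'n perm \<Rightarrow> bool" where
  "wf_perm p \<longleftrightarrow> (\<forall>(a, b) \<in> set p. atom_sort a = atom_sort b)"

text \<open>The rightmost swapping acts first, so that \<open>p @ q\<close> is the product and \<open>rev p\<close> the inverse.\<close>

definition perm_atom :: "'n perm \<Rightarrow> 'n atom \<Rightarrow> 'n atom" where
  "perm_atom p c = foldr (\<lambda>(a, b). transpose a b) p c"

primrec perm_nterm :: "'n perm \<Rightarrow> ('n, 'd, 'f) nterm \<Rightarrow> ('n, 'd, 'f) nterm" where
  "perm_nterm p (NFun f ts) = NFun f (map (perm_nterm p) ts)"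
| "perm_nterm p (NAtom a) = NAtom (perm_atom p a)"
| "perm_nterm p (NAbst a t) = NAbst (perm_atom p a) (perm_nterm p t)"
| "perm_nterm p (NSusp q X) = NSusp (p @ q) X"

inductive nterm_typed ::
  "('n, 'd, 'f) arity \<Rightarrow> ('n, 'd, 'f) nterm \<Rightarrow> ('n, 'd) nty \<Rightarrow> bool"
  for ar :: "('n, 'd, 'f) arity" where
  fun_typed: "ar f = (Ts, T) \<Longrightarrow> list_all2 (nterm_typed ar) ts Ts \<Longrightarrow> nterm_typed ar (NFun f ts) T"
| atom_typed: "nterm_typed ar (NAtom a) (NAtomSort (atom_sort a))"
| abst_typed: "nterm_typed ar t T \<Longrightarrow> nterm_typed ar (NAbst a t) (NAbs (atom_sort a) T)"
| susp_typed: "wf_perm p \<Longrightarrow> nterm_typed ar (NSusp p X) (unk_sort X)"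

type_synonym ('n, 'd, 'f) nsubst = "('n, 'd) unk \<Rightarrow> ('n, 'd, 'f) nterm"

primrec nsubst :: "('n, 'd, 'f) nsubst \<Rightarrow> ('n, 'd, 'f) nterm \<Rightarrow> ('n, 'd, 'f) nterm" where
  "nsubst \<sigma> (NFun f ts) = NFun f (map (nsubst \<sigma>) ts)"
| "nsubst \<sigma> (NAtom a) = NAtom a"
| "nsubst \<sigma> (NAbst a t) = NAbst a (nsubst \<sigma> t)"
| "nsubst \<sigma> (NSusp p X) = perm_nterm p (\<sigma> X)"

definition is_nsubst :: "('n, 'd, 'f) arity \<Rightarrow> ('n, 'd, 'f) nsubst \<Rightarrow> bool" where
  "is_nsubst ar \<sigma> \<longleftrightarrow>
     finite {X. \<sigma> X \<noteq> NSusp [] X} \<and> (\<forall>X. nterm_typed ar (\<sigma> X) (unk_sort X))"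

type_synonym ('n, 'd) fresh_env = "('n atom \<times> ('n, 'd) unk) set"

inductive fresh :: "('n, 'd) fresh_env \<Rightarrow> 'n atom \<Rightarrow> ('n, 'd, 'f) nterm \<Rightarrow> bool"
  for \<Delta> :: "('n, 'd) fresh_env" where
  fresh_atom: "a \<noteq> a' \<Longrightarrow> fresh \<Delta> a (NAtom a')"
| fresh_susp: "(perm_atom (rev p) a, X) \<in> \<Delta> \<Longrightarrow> fresh \<Delta> a (NSusp p X)"
| fresh_fun: "(\<forall>t \<in> set ts. fresh \<Delta> a t) \<Longrightarrow> fresh \<Delta> a (NFun f ts)"
| fresh_abst_same: "fresh \<Delta> a (NAbst a t)"
| fresh_abst_diff: "a \<noteq> a' \<Longrightarrow> fresh \<Delta> a t \<Longrightarrow> fresh \<Delta> a (NAbst a' t)"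

inductive napprox :: "('n, 'd) fresh_env \<Rightarrow> ('n, 'd, 'f) nterm \<Rightarrow> ('n, 'd, 'f) nterm \<Rightarrow> bool"
  for \<Delta> :: "('n, 'd) fresh_env" where
  napprox_atom: "napprox \<Delta> (NAtom a) (NAtom a)"
| napprox_susp: "(\<forall>a. perm_atom p a \<noteq> perm_atom q a \<longrightarrow> (a, X) \<in> \<Delta>) \<Longrightarrow>
    napprox \<Delta> (NSusp p X) (NSusp q X)"
| napprox_fun: "list_all2 (napprox \<Delta>) ts us \<Longrightarrow> napprox \<Delta> (NFun f ts) (NFun f us)"
| napprox_abst_same: "napprox \<Delta> t u \<Longrightarrow> napprox \<Delta> (NAbst a t) (NAbst a u)"
| napprox_abst_diff: "a \<noteq> a' \<Longrightarrow> napprox \<Delta> t (perm_nterm [(a, a')] u) \<Longrightarrow> fresh \<Delta> a u \<Longrightarrow>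
    napprox \<Delta> (NAbst a t) (NAbst a' u)"

type_synonym ('n, 'd, 'f) nproblem = "(('n, 'd, 'f) nterm \<times> ('n, 'd, 'f) nterm) set"

definition is_nproblem :: "('n, 'd, 'f) arity \<Rightarrow> ('n, 'd, 'f) nproblem \<Rightarrow> bool" where
  "is_nproblem ar P \<longleftrightarrow>
     finite P \<and> (\<forall>(t, u) \<in> P. \<exists>T. nterm_typed ar t T \<and> nterm_typed ar u T)"

definition nsolution ::
  "('n, 'd, 'f) arity \<Rightarrow> ('n, 'd) fresh_env \<Rightarrow> ('n, 'd, 'f) nsubst \<Rightarrow> ('n, 'd, 'f) nproblem \<Rightarrow> bool"
  where
  "nsolution ar \<Delta> \<sigma> P \<longleftrightarrow>
     finite \<Delta> \<and> is_nsubst ar \<sigma> \<and> (\<forall>(t, u) \<in> P. napprox \<Delta> (nsubst \<sigma> t) (nsubst \<sigma> u))"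

definition nsolvable :: "('n, 'd, 'f) arity \<Rightarrow> ('n, 'd, 'f) nproblem \<Rightarrow> bool" where
  "nsolvable ar P \<longleftrightarrow> (\<exists>\<Delta> \<sigma>. nsolution ar \<Delta> \<sigma> P)"

text \<open>Atoms occurring in swappings and in binding position count as occurring.\<close>

primrec nterm_atoms :: "('n, 'd, 'f) nterm \<Rightarrow> 'n atom set" where
  "nterm_atoms (NFun f ts) = \<Union> (set (map nterm_atoms ts))"
| "nterm_atoms (NAtom a) = {a}"
| "nterm_atoms (NAbst a t) = insert a (nterm_atoms t)"
| "nterm_atoms (NSusp p X) = fst ` set p \<union> snd ` set p"

definition nproblem_atoms :: "('n, 'd, 'f) nproblem \<Rightarrow> 'n atom set" where
  "nproblem_atoms P = (\<Union>(t, u) \<in> P. nterm_atoms t \<union> nterm_atoms u)"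


section \<open>Simply typed lambda-terms\<close>

text \<open>
  Terms modulo \<open>\<alpha>\<close> are represented with de Bruijn indices for bound variables and names for free
  variables. As in Church-style typing, a free variable consists of a name and a type.
\<close>

datatype ('n, 'd) lty =
    BaseAtom 'n
  | BaseData 'd
  | Arrow "('n, 'd) lty" "('n, 'd) lty"

datatype ('n, 'd) lname = AtomName "'n atom" | UnkName "('n, 'd) unk"

datatype ('n, 'd) lvar = LVar (lvar_name: "('n, 'd) lname") (lvar_type: "('n, 'd) lty")

datatype ('n, 'd, 'f) lterm =
    Free "('n, 'd) lvar"
  | Bound nat
  | Const 'f
  | App "('n, 'd, 'f) lterm" "('n, 'd, 'f) lterm"
  | Lam "('n, 'd) lty" "('n, 'd, 'f) lterm"

primrec lift :: "nat \<Rightarrow> ('n, 'd, 'f) lterm \<Rightarrow> ('n, 'd, 'f) lterm" where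
  "lift k (Free x) = Free x"
| "lift k (Bound i) = (if i < k then Bound i else Bound (Suc i))"
| "lift k (Const c) = Const c"
| "lift k (App s t) = App (lift k s) (lift k t)"
| "lift k (Lam T s) = Lam T (lift (Suc k) s)"

text \<open>\<open>inst k u s\<close> replaces index \<open>k\<close> by \<open>u\<close> and removes it from the bound context.\<close>

primrec inst :: "nat \<Rightarrow> ('n, 'd, 'f) lterm \<Rightarrow> ('n, 'd, 'f) lterm \<Rightarrow> ('n, 'd, 'f) lterm" where
  "inst k u (Free x) = Free x"
| "inst k u (Bound i) = (if k < i then Bound (i - 1) else if i = k then u else Bound i)"
| "inst k u (Const c) = Const c"
| "inst k u (App s t) = App (inst k u s) (inst k u t)"
| "inst k u (Lam T s) = Lam T (inst (Suc k) (lift 0 u) s)"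

text \<open>\<open>lambda x s\<close> is the abstraction of the named variable \<open>x\<close> in \<open>s\<close>.\<close>

primrec bind :: "nat \<Rightarrow> ('n, 'd) lvar \<Rightarrow> ('n, 'd, 'f) lterm \<Rightarrow> ('n, 'd, 'f) lterm" where
  "bind k x (Free y) = (if y = x then Bound k else Free y)"
| "bind k x (Bound i) = (if i < k then Bound i else Bound (Suc i))"
| "bind k x (Const c) = Const c"
| "bind k x (App s t) = App (bind k x s) (bind k x t)"
| "bind k x (Lam T s) = Lam T (bind (Suc k) x s)"

definition lambda :: "('n, 'd) lvar \<Rightarrow> ('n, 'd, 'f) lterm \<Rightarrow> ('n, 'd, 'f) lterm" where
  "lambda x s = Lam (lvar_type x) (bind 0 x s)"

definition lambdas :: "('n, 'd) lvar list \<Rightarrow> ('n, 'd, 'f) lterm \<Rightarrow> ('n, 'd, 'f) lterm" where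
  "lambdas xs s = foldr lambda xs s"

definition apps :: "('n, 'd, 'f) lterm \<Rightarrow> ('n, 'd, 'f) lterm list \<Rightarrow> ('n, 'd, 'f) lterm" where
  "apps s ts = foldl App s ts"

definition arrows :: "('n, 'd) lty list \<Rightarrow> ('n, 'd) lty \<Rightarrow> ('n, 'd) lty" where
  "arrows Ts T = foldr Arrow Ts T"

text \<open>The type of constants is given by \<open>cty\<close>, that of the bound variables by the list \<open>\<Gamma>\<close>.\<close>

inductive lterm_typed ::
  "('f \<Rightarrow> ('n, 'd) lty) \<Rightarrow> ('n, 'd) lty list \<Rightarrow> ('n, 'd, 'f) lterm \<Rightarrow> ('n, 'd) lty \<Rightarrow> bool"
  for cty :: "'f \<Rightarrow> ('n, 'd) lty" where
  Free_typed: "lterm_typed cty \<Gamma> (Free x) (lvar_type x)"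
| Bound_typed: "i < length \<Gamma> \<Longrightarrow> lterm_typed cty \<Gamma> (Bound i) (\<Gamma> ! i)"
| Const_typed: "lterm_typed cty \<Gamma> (Const c) (cty c)"
| App_typed: "lterm_typed cty \<Gamma> s (Arrow T U) \<Longrightarrow> lterm_typed cty \<Gamma> t T \<Longrightarrow>
    lterm_typed cty \<Gamma> (App s t) U"
| Lam_typed: "lterm_typed cty (T # \<Gamma>) s U \<Longrightarrow> lterm_typed cty \<Gamma> (Lam T s) (Arrow T U)"

inductive beta_eta :: "('n, 'd, 'f) lterm \<Rightarrow> ('n, 'd, 'f) lterm \<Rightarrow> bool" where
  beta: "beta_eta (App (Lam T s) t) (inst 0 t s)"
| eta: "beta_eta (Lam T (App (lift 0 s) (Bound 0))) s"
| App_left: "beta_eta s s' \<Longrightarrow> beta_eta (App s t) (App s' t)"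
| App_right: "beta_eta t t' \<Longrightarrow> beta_eta (App s t) (App s t')"
| Lam_body: "beta_eta s s' \<Longrightarrow> beta_eta (Lam T s) (Lam T s')"

text \<open>
  Equality modulo \<open>\<alpha>\<beta>\<eta>\<close> between well-typed terms. All intermediate terms have to be
  well-typed, since conversion through ill-typed terms could change type annotations.
\<close>

definition beta_eta_eq ::
  "('f \<Rightarrow> ('n, 'd) lty) \<Rightarrow> ('n, 'd) lty \<Rightarrow> ('n, 'd, 'f) lterm \<Rightarrow> ('n, 'd, 'f) lterm \<Rightarrow> bool" where
  "beta_eta_eq cty T s t \<longleftrightarrow>
     lterm_typed cty [] s T \<and> lterm_typed cty [] t T \<and>
     equivclp (\<lambda>u v. lterm_typed cty [] u T \<and> lterm_typed cty [] v T \<and> beta_eta u v) s t"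

type_synonym ('n, 'd, 'f) lsubst = "('n, 'd) lvar \<Rightarrow> ('n, 'd, 'f) lterm"

text \<open>
  The values of a substitution are required to be typed in the empty bound context (see
  \<open>is_lsubst\<close>), so they have no dangling indices and need no lifting under binders.
\<close>

primrec lsubst :: "('n, 'd, 'f) lsubst \<Rightarrow> ('n, 'd, 'f) lterm \<Rightarrow> ('n, 'd, 'f) lterm" where
  "lsubst \<theta> (Free x) = \<theta> x"
| "lsubst \<theta> (Bound i) = Bound i"
| "lsubst \<theta> (Const c) = Const c"
| "lsubst \<theta> (App s t) = App (lsubst \<theta> s) (lsubst \<theta> t)"
| "lsubst \<theta> (Lam T s) = Lam T (lsubst \<theta> s)"

definition is_lsubst :: "('f \<Rightarrow> ('n, 'd) lty) \<Rightarrow> ('n, 'd, 'f) lsubst \<Rightarrow> bool" where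
  "is_lsubst cty \<theta> \<longleftrightarrow>
     finite {x. \<theta> x \<noteq> Free x} \<and> (\<forall>x. lterm_typed cty [] (\<theta> x) (lvar_type x))"

type_synonym ('n, 'd, 'f) lproblem = "(('n, 'd, 'f) lterm \<times> ('n, 'd, 'f) lterm) set"

definition lsolvable :: "('f \<Rightarrow> ('n, 'd) lty) \<Rightarrow> ('n, 'd, 'f) lproblem \<Rightarrow> bool" where
  "lsolvable cty Q \<longleftrightarrow>
     (\<exists>\<theta>. is_lsubst cty \<theta> \<and>
       (\<forall>(s, s') \<in> Q. \<exists>T. beta_eta_eq cty T (lsubst \<theta> s) (lsubst \<theta> s')))"


section \<open>The translation\<close>

primrec trans_ty :: "('n, 'd) nty \<Rightarrow> ('n, 'd) lty" where
  "trans_ty (NAtomSort n) = BaseAtom n"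
| "trans_ty (NDataSort d) = BaseData d"
| "trans_ty (NAbs n T) = Arrow (BaseAtom n) (trans_ty T)"

definition trans_arity :: "('n, 'd, 'f) arity \<Rightarrow> 'f \<Rightarrow> ('n, 'd) lty" where
  "trans_arity ar f = (case ar f of (Ts, T) \<Rightarrow> arrows (map trans_ty Ts) (trans_ty T))"

definition atom_var :: "'n atom \<Rightarrow> ('n, 'd) lvar" where
  "atom_var a = LVar (AtomName a) (trans_ty (NAtomSort (atom_sort a)))"

definition unk_var :: "'n atom list \<Rightarrow> ('n, 'd) unk \<Rightarrow> ('n, 'd) lvar" where
  "unk_var as X =
     LVar (UnkName X)
       (arrows (map (\<lambda>a. trans_ty (NAtomSort (atom_sort a))) as) (trans_ty (unk_sort X)))"

primrec trans_nterm :: "'n atom list \<Rightarrow> ('n, 'd, 'f) nterm \<Rightarrow> ('n, 'd, 'f) lterm" where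
  "trans_nterm as (NFun f ts) = apps (Const f) (map (trans_nterm as) ts)"
| "trans_nterm as (NAtom a) = Free (atom_var a)"
| "trans_nterm as (NAbst a t) = lambda (atom_var a) (trans_nterm as t)"
| "trans_nterm as (NSusp p X) =
     apps (Free (unk_var as X)) (map (\<lambda>a. Free (atom_var (perm_atom p a))) as)"

definition trans_problem ::
  "'n atom list \<Rightarrow> ('n, 'd, 'f) nproblem \<Rightarrow> ('n, 'd, 'f) lproblem" where
  "trans_problem as P =
     (\<lambda>(t, u). (lambdas (map atom_var as) (trans_nterm as t),
                lambdas (map atom_var as) (trans_nterm as u))) ` P"

end

theory Submission
  imports Defs
begin

text \<open>
  Let \<open>\<langle>\<nabla>, \<sigma>\<rangle>\<close> solve \<open>P\<close>. Read a nominal term as a lambda-term by turning every suspension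
  \<open>\<pi>\<cdot>X\<close> into a free variable \<open>X\<close> that depends on no atom at all. Every atom is then fresh for \<open>X\<close>,
  so freshness and nominal equality under any \<open>\<nabla>\<close> become non-occurrence and \<open>\<alpha>\<close>-equality.
  The higher-order solution sends \<open>X\<close> to \<open>\<lambda>a\<^sub>1 \<dots> a\<^sub>n. \<sigma>(X)\<close>, read in this way: applying it to
  \<open>\<pi>\<cdot>a\<^sub>1, \<dots>, \<pi>\<cdot>a\<^sub>n\<close> \<open>\<beta>\<close>-reduces to the reading of \<open>\<pi>\<cdot>\<sigma>(X)\<close>, because \<open>\<pi>\<close> moves only atoms
  among the \<open>a\<^sub>i\<close>. Atoms of \<open>\<sigma>(X)\<close> other than the \<open>a\<^sub>i\<close> stay free and are never captured, since all
  binders of \<open>P\<close> are among the \<open>a\<^sub>i\<close>.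
\<close>

section \<open>Lambda-terms\<close>

primrec lterm_frees :: "('n, 'd, 'f) lterm \<Rightarrow> ('n, 'd) lvar set" where
  "lterm_frees (Free x) = {x}"
| "lterm_frees (Bound i) = {}"
| "lterm_frees (Const c) = {}"
| "lterm_frees (App s t) = lterm_frees s \<union> lterm_frees t"
| "lterm_frees (Lam T s) = lterm_frees s"

lemma frees_bind: "lterm_frees (bind k x s) = lterm_frees s - {x}"
  by (induction s arbitrary: k) auto

lemma frees_lambda: "lterm_frees (lambda x s) = lterm_frees s - {x}"
  by (simp add: lambda_def frees_bind)

lemma frees_lambdas: "lterm_frees (lambdas xs s) = lterm_frees s - set xs"
  by (induction xs) (auto simp: lambdas_def frees_lambda)

lemma frees_apps: "lterm_frees (apps s ts) = lterm_frees s \<union> (\<Union>t \<in> set ts. lterm_frees t)"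
  by (induction ts arbitrary: s) (auto simp: apps_def)

lemma apps_simps [simp]: "apps s [] = s" "apps s (t # ts) = apps (App s t) ts"
  by (simp_all add: apps_def)

lemma lambdas_simps [simp]: "lambdas [] s = s" "lambdas (x # xs) s = lambda x (lambdas xs s)"
  by (simp_all add: lambdas_def)

lemma arrows_simps [simp]: "arrows [] T = T" "arrows (U # Us) T = Arrow U (arrows Us T)"
  by (simp_all add: arrows_def)

lemma lsubst_apps: "lsubst \<theta> (apps s ts) = apps (lsubst \<theta> s) (map (lsubst \<theta>) ts)"
  by (induction ts arbitrary: s) auto

lemma lsubst_Free [simp]: "lsubst Free s = s"
  by (induction s) auto

text \<open>A term typed in \<open>\<Gamma>\<close> has no loose index from \<open>k\<close> on, so
  \<open>bind\<close> shifts nothing; with \<open>x\<close> absent it changes nothing at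
  all.\<close>

lemma bind_closed:
  assumes "lterm_typed cty \<Gamma> s U" "x \<notin> lterm_frees s" "length \<Gamma> \<le> k"
  shows "bind k x s = s"
  using assms by (induction arbitrary: k) auto

text \<open>The second assumption excludes capture: it makes each value insensitive to binding
  \<open>x\<close> at any depth.\<close>

lemma lsubst_bind:
  assumes "\<theta> x = Free x" "\<And>y k. y \<noteq> x \<Longrightarrow> bind k x (\<theta> y) = \<theta> y"
  shows "lsubst \<theta> (bind k x s) = bind k x (lsubst \<theta> s)"
  using assms by (induction s arbitrary: k) auto

lemma lsubst_lambda:
  assumes "\<theta> x = Free x" "\<And>y k. y \<noteq> x \<Longrightarrow> bind k x (\<theta> y) = \<theta> y"
  shows "lsubst \<theta> (lambda x s) = lambda x (lsubst \<theta> s)"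
  using lsubst_bind[of \<theta> x, OF assms] by (simp add: lambda_def)

lemma rename_bind:
  assumes "inj r"
  shows "lsubst (Free \<circ> r) (bind k x s) = bind k (r x) (lsubst (Free \<circ> r) s)"
  using assms by (induction s arbitrary: k) (auto simp: inj_eq)

text \<open>This is \<alpha>-conversion: in de Bruijn form, renaming the bound variable to a fresh
  one gives the very same term.\<close>

lemma bind_rename:
  assumes "\<And>z. z \<in> lterm_frees s \<Longrightarrow> r z = (if z = y then x else z)" "x \<notin> lterm_frees s"
  shows "bind k x (lsubst (Free \<circ> r) s) = bind k y s"
  using assms by (induction s arbitrary: k) auto

text \<open>The occurrences of \<open>x\<close> are already indices when \<open>r\<close> acts, so
  \<open>r\<close> touches neither them nor the inserted \<open>y\<close>. The result is a single
  updated renaming.\<close>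

lemma inst_rename_bind:
  "inst k (Free y) (lsubst (Free \<circ> r) (bind k x s)) = lsubst (Free \<circ> r(x := y)) s"
  by (induction s arbitrary: k) auto

lemma bind_lift: "j \<le> k \<Longrightarrow> bind (Suc k) x (lift j s) = lift j (bind k x s)"
  by (induction s arbitrary: j k) auto

text \<open>While index \<open>j\<close> is still present in \<open>s\<close>, position
  \<open>k\<close> counts as \<open>Suc k\<close>. This carries a contraction through
  \<open>bind\<close>.\<close>

lemma bind_inst: "j \<le> k \<Longrightarrow> bind k x (inst j u s) = inst j (bind k x u) (bind (Suc k) x s)"
  by (induction s arbitrary: j k u) (auto simp: bind_lift)


section \<open>Typing\<close>

text \<open>Appending at the far end of the context renumbers no index, so closed substitution
  values can be typed under binders without lifting.\<close>

lemma typed_weaken: "lterm_typed cty \<Gamma> s U \<Longrightarrow> lterm_typed cty (\<Gamma> @ \<Delta>) s U"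
proof (induction rule: lterm_typed.induct)
  case (Bound_typed i \<Gamma>)
  then show ?case using lterm_typed.Bound_typed[of i "\<Gamma> @ \<Delta>"] by (simp add: nth_append)
qed (auto intro: lterm_typed.intros)

lemma typed_Bound: "i < length \<Gamma> \<Longrightarrow> \<Gamma> ! i = U \<Longrightarrow> lterm_typed cty \<Gamma> (Bound i) U"
  using lterm_typed.Bound_typed by blast

lemma typed_bind:
  assumes "lterm_typed cty (\<Delta> @ \<Gamma>) s U"
  shows "lterm_typed cty (\<Delta> @ lvar_type x # \<Gamma>) (bind (length \<Delta>) x s) U"
  using assms
proof (induction "\<Delta> @ \<Gamma>" s U arbitrary: \<Delta> rule: lterm_typed.induct)
  case (Lam_typed T s U)
  then show ?case using Lam_typed(2)[of "T # \<Delta>"] by (auto intro: lterm_typed.intros)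
qed (auto intro: lterm_typed.intros intro!: typed_Bound simp: nth_append)

lemma typed_lambda:
  "lterm_typed cty [] s U \<Longrightarrow> lterm_typed cty [] (lambda x s) (Arrow (lvar_type x) U)"
  using typed_bind[of cty "[]" "[]" s U] by (auto simp: lambda_def intro: lterm_typed.intros)

lemma typed_lambdas:
  "lterm_typed cty [] s U \<Longrightarrow> lterm_typed cty [] (lambdas xs s) (arrows (map lvar_type xs) U)"
  by (induction xs) (auto intro: typed_lambda)

lemma typed_apps:
  assumes "lterm_typed cty \<Gamma> s (arrows Ts U)" "list_all2 (lterm_typed cty \<Gamma>) ts Ts"
  shows "lterm_typed cty \<Gamma> (apps s ts) U"
  using assms(2,1)
  by (induction arbitrary: s rule: list_all2_induct) (auto intro: lterm_typed.intros)

lemma typed_lsubst: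
  assumes "lterm_typed cty \<Gamma> s U" "\<And>x. lterm_typed cty [] (\<theta> x) (lvar_type x)"
  shows "lterm_typed cty \<Gamma> (lsubst \<theta> s) U"
  using assms(1)
proof induction
  case (Free_typed \<Gamma> x)
  then show ?case using typed_weaken[OF assms(2)[of x], of \<Gamma>] by simp
qed (auto intro: lterm_typed.intros)

lemma typed_lift:
  assumes "lterm_typed cty (\<Delta> @ \<Gamma>) s U"
  shows "lterm_typed cty (\<Delta> @ T # \<Gamma>) (lift (length \<Delta>) s) U"
  using assms
proof (induction "\<Delta> @ \<Gamma>" s U arbitrary: \<Delta> rule: lterm_typed.induct)
  case (Lam_typed V s U)
  then show ?case using Lam_typed(2)[of "V # \<Delta>"] by (auto intro: lterm_typed.intros)
qed (auto intro: lterm_typed.intros intro!: typed_Bound simp: nth_append)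

lemma typed_inst:
  assumes "lterm_typed cty (\<Delta> @ T # \<Gamma>) s U" "lterm_typed cty (\<Delta> @ \<Gamma>) u T"
  shows "lterm_typed cty (\<Delta> @ \<Gamma>) (inst (length \<Delta>) u s) U"
  using assms
proof (induction "\<Delta> @ T # \<Gamma>" s U arbitrary: \<Delta> u rule: lterm_typed.induct)
  case (Bound_typed i)
  then show ?case by (auto intro!: typed_Bound simp: nth_append nth_Cons')
next
  case (Lam_typed V s U)
  then show ?case
    using Lam_typed(2)[of "V # \<Delta>" "lift 0 u"] typed_lift[of cty "[]" "\<Delta> @ \<Gamma>" u T V]
    by (auto intro: lterm_typed.intros)
qed (auto intro: lterm_typed.intros)


section \<open>Beta-reduction\<close>

inductive beta_red :: "('n, 'd, 'f) lterm \<Rightarrow> ('n, 'd, 'f) lterm \<Rightarrow> bool" where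
  contract: "beta_red (App (Lam T s) t) (inst 0 t s)"
| red_App_left: "beta_red s s' \<Longrightarrow> beta_red (App s t) (App s' t)"
| red_App_right: "beta_red t t' \<Longrightarrow> beta_red (App s t) (App s t')"
| red_Lam: "beta_red s s' \<Longrightarrow> beta_red (Lam T s) (Lam T s')"

lemma beta_red_beta_eta: "beta_red s t \<Longrightarrow> beta_eta s t"
  by (induction rule: beta_red.induct) (auto intro: beta_eta.intros)

inductive_cases typed_AppE: "lterm_typed cty \<Gamma> (App s t) U"
inductive_cases typed_LamE: "lterm_typed cty \<Gamma> (Lam T s) U"

text \<open>\<open>beta_eta_eq\<close> requires every intermediate term to be typed; this supplies
  the types along a reduction.\<close>

lemma subject_reduction:
  assumes "beta_red s t" "lterm_typed cty \<Gamma> s U"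
  shows "lterm_typed cty \<Gamma> t U"
  using assms
proof (induction arbitrary: \<Gamma> U rule: beta_red.induct)
  case (contract T s t)
  then show ?case
    using typed_inst[of cty "[]" T \<Gamma> s U t] by (auto elim!: typed_AppE typed_LamE)
qed (auto elim!: typed_AppE typed_LamE intro: lterm_typed.intros)

lemma beta_red_bind: "beta_red s t \<Longrightarrow> beta_red (bind k x s) (bind k x t)"
proof (induction arbitrary: k rule: beta_red.induct)
  case (contract T s t)
  then show ?case using beta_red.contract by (auto simp: bind_inst)
qed (auto intro: beta_red.intros)

lemma beta_reds_lambda: "beta_red\<^sup>*\<^sup>* s t \<Longrightarrow> beta_red\<^sup>*\<^sup>* (lambda x s) (lambda x t)"
  unfolding lambda_def
  by (induction rule: rtranclp_induct)
    (auto intro: rtranclp.rtrancl_into_rtrancl red_Lam beta_red_bind)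

lemma beta_reds_lambdas: "beta_red\<^sup>*\<^sup>* s t \<Longrightarrow> beta_red\<^sup>*\<^sup>* (lambdas xs s) (lambdas xs t)"
  by (induction xs) (auto intro: beta_reds_lambda)

lemma beta_reds_App:
  assumes "beta_red\<^sup>*\<^sup>* s s'" "beta_red\<^sup>*\<^sup>* t t'"
  shows "beta_red\<^sup>*\<^sup>* (App s t) (App s' t')"
proof -
  have "beta_red\<^sup>*\<^sup>* (App s t) (App s' t)"
    using assms(1)
    by (induction rule: rtranclp_induct) (auto intro: rtranclp.rtrancl_into_rtrancl red_App_left)
  also have "beta_red\<^sup>*\<^sup>* (App s' t) (App s' t')"
    using assms(2)
    by (induction rule: rtranclp_induct) (auto intro: rtranclp.rtrancl_into_rtrancl red_App_right)
  finally show ?thesis .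
qed

lemma beta_reds_apps:
  assumes "beta_red\<^sup>*\<^sup>* s s'" "list_all2 beta_red\<^sup>*\<^sup>* ts ts'"
  shows "beta_red\<^sup>*\<^sup>* (apps s ts) (apps s' ts')"
  using assms(2,1)
  by (induction arbitrary: s s' rule: list_all2_induct) (auto intro: beta_reds_App)

text \<open>
  The accumulated renaming \<open>r\<close> is applied outside the remaining abstractions, where its values
  cannot be captured by them; this makes the nested contractions a simultaneous renaming.
\<close>

lemma beta_reds_apps_lambdas_rename:
  "beta_red\<^sup>*\<^sup>* (apps (lsubst (Free \<circ> r) (lambdas xs s)) (map (Free \<circ> g) xs))
     (lsubst (Free \<circ> (\<lambda>y. if y \<in> set xs then g y else r y)) s)"
proof (induction xs arbitrary: r)
  case Nil
  then show ?case by simp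
next
  case (Cons x xs)
  have "beta_red (App (lsubst (Free \<circ> r) (lambda x (lambdas xs s))) (Free (g x)))
      (lsubst (Free \<circ> r(x := g x)) (lambdas xs s))"
    using beta_red.contract[of "lvar_type x" "lsubst (Free \<circ> r) (bind 0 x (lambdas xs s))" "Free (g x)"]
    by (simp only: inst_rename_bind lambda_def lsubst.simps)
  then have head: "beta_red\<^sup>*\<^sup>* (apps (lsubst (Free \<circ> r) (lambdas (x # xs) s)) (map (Free \<circ> g) (x # xs)))
      (apps (lsubst (Free \<circ> r(x := g x)) (lambdas xs s)) (map (Free \<circ> g) xs))"
    by (simp only: list.map apps_simps lambdas_simps comp_apply)
      (intro beta_reds_apps list_all2_refl r_into_rtranclp rtranclp.rtrancl_refl)
  \<comment> \<open>If \<open>x\<close> occurs again in \<open>xs\<close>, both sides still give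
    \<open>g x\<close>.\<close>
  have "(\<lambda>y. if y \<in> set xs then g y else (r(x := g x)) y) =
      (\<lambda>y. if y \<in> set (x # xs) then g y else r y)"
    by (simp add: fun_eq_iff)
  with rtranclp_trans[OF head Cons.IH] show ?case by (simp only:)
qed

text \<open>Both reductions to \<open>v\<close> are typed conversions by subject reduction; one
  followed by the reverse of the other links \<open>s\<close> to \<open>t\<close>.\<close>

lemma beta_eta_eq_if_joinable:
  assumes "lterm_typed cty [] s T" "lterm_typed cty [] t T" "beta_red\<^sup>*\<^sup>* s v" "beta_red\<^sup>*\<^sup>* t v"
  shows "beta_eta_eq cty T s t"
proof -
  let ?R = "\<lambda>u v. lterm_typed cty [] u T \<and> lterm_typed cty [] v T \<and> beta_eta u v"
  have *: "lterm_typed cty [] v T \<and> equivclp ?R s v"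
    if "beta_red\<^sup>*\<^sup>* s v" "lterm_typed cty [] s T" for s v
    using that
  proof (induction rule: rtranclp_induct)
    case base
    then show ?case by simp
  next
    case (step u v)
    then show ?case
      by (auto intro: subject_reduction beta_red_beta_eta equivclp_into_equivclp)
  qed
  have "equivclp ?R s t"
    using equivclp_trans[OF conjunct2[OF *[OF assms(3,1)]]
        equivclp_sym[OF conjunct2[OF *[OF assms(4,2)]]]] .
  then show ?thesis
    using assms(1,2) by (simp add: beta_eta_eq_def)
qed


section \<open>Nominal terms\<close>

lemma perm_atom_simps [simp]:
  "perm_atom [] c = c"
  "perm_atom ((a, b) # p) c = transpose a b (perm_atom p c)"
  by (simp_all add: perm_atom_def)

lemma inj_perm_atom: "inj (perm_atom p)"
proof (induction p)
  case Nil
  then show ?case by (simp add: inj_def)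
next
  case (Cons ab p)
  obtain a b where "ab = (a, b)" by fastforce
  then have "perm_atom (ab # p) = transpose a b \<circ> perm_atom p" by auto
  then show ?case using Cons inj_compose[OF bij_is_inj[OF bij_transpose]] by metis
qed

lemma perm_atom_outside: "c \<notin> fst ` set p \<union> snd ` set p \<Longrightarrow> perm_atom p c = c"
  by (induction p) (auto simp: transpose_def)

lemma atom_sort_perm_atom: "wf_perm p \<Longrightarrow> atom_sort (perm_atom p c) = atom_sort c"
proof (induction p)
  case (Cons ab p)
  obtain a b where ab: "ab = (a, b)" by fastforce
  have "atom_sort a = atom_sort b" "wf_perm p"
    using Cons.prems by (auto simp: ab wf_perm_def)
  then have "atom_sort (transpose a b d) = atom_sort d" for d
    by (simp add: transpose_def)
  then show ?case using Cons.IH \<open>wf_perm p\<close> by (simp only: ab perm_atom_simps)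
qed simp

lemma perm_nterm_typed:
  assumes "nterm_typed ar t T" "wf_perm p"
  shows "nterm_typed ar (perm_nterm p t) T"
  using assms
proof (induction rule: nterm_typed.induct)
  case (fun_typed f Ts T ts)
  then show ?case
    by (auto intro!: nterm_typed.fun_typed simp: list_all2_map1 elim: list_all2_mono)
next
  case (atom_typed a)
  then show ?case
    using nterm_typed.atom_typed[of ar "perm_atom p a"] by (simp add: atom_sort_perm_atom)
next
  case (abst_typed t T a)
  then show ?case
    using nterm_typed.abst_typed[of ar "perm_nterm p t" T "perm_atom p a"]
    by (simp add: atom_sort_perm_atom)
next
  case (susp_typed q X)
  then show ?case
    using nterm_typed.susp_typed[of "p @ q" ar X] by (auto simp: wf_perm_def)
qed

lemma nsubst_typed:
  assumes "nterm_typed ar t T" "is_nsubst ar \<sigma>"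
  shows "nterm_typed ar (nsubst \<sigma> t) T"
  using assms
proof (induction rule: nterm_typed.induct)
  case (fun_typed f Ts T ts)
  then show ?case
    by (auto intro!: nterm_typed.fun_typed simp: list_all2_map1 elim: list_all2_mono)
qed (auto intro: nterm_typed.intros perm_nterm_typed simp: is_nsubst_def)

text \<open>These variables bound the support of the higher-order substitution, which has to be
  finite.\<close>

primrec nterm_unks :: "('n, 'd, 'f) nterm \<Rightarrow> ('n, 'd) unk set" where
  "nterm_unks (NFun f ts) = \<Union> (set (map nterm_unks ts))"
| "nterm_unks (NAtom a) = {}"
| "nterm_unks (NAbst a t) = nterm_unks t"
| "nterm_unks (NSusp p X) = {X}"

lemma finite_nterm_unks: "finite (nterm_unks t)"
  by (induction t) auto


section \<open>Reading nominal terms without dependence on atoms\<close>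

text \<open>A suspension loses \<open>p\<close>: its variable takes no atom arguments and has the
  translated sort of \<open>X\<close> as its type, without the arrows of
  \<open>unk_var\<close>.\<close>

primrec ground_trans :: "('n, 'd, 'f) nterm \<Rightarrow> ('n, 'd, 'f) lterm" where
  "ground_trans (NFun f ts) = apps (Const f) (map ground_trans ts)"
| "ground_trans (NAtom a) = Free (atom_var a)"
| "ground_trans (NAbst a t) = lambda (atom_var a) (ground_trans t)"
| "ground_trans (NSusp p X) = Free (LVar (UnkName X) (trans_ty (unk_sort X)))"

lemma atom_var_eq_iff [simp]: "atom_var a = atom_var b \<longleftrightarrow> a = b"
  by (auto simp: atom_var_def)

lemma lvar_type_atom_var [simp]: "lvar_type (atom_var a) = BaseAtom (atom_sort a)"
  by (simp add: atom_var_def)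

lemma typed_atom_var:
  "lterm_typed cty \<Gamma> (Free (atom_var a)) (BaseAtom (atom_sort a))"
  using lterm_typed.Free_typed[of cty \<Gamma> "atom_var a"] by simp

text \<open>The parameter \<open>g\<close> lets both \<open>ground_trans\<close> and
  \<open>trans_nterm\<close> use this for function symbols.\<close>

lemma typed_Const_apps:
  assumes "ar f = (Ts, T)"
    and "list_all2 (\<lambda>t T. lterm_typed (trans_arity ar) [] (g t) (trans_ty T)) ts Ts"
  shows "lterm_typed (trans_arity ar) [] (apps (Const f) (map g ts)) (trans_ty T)"
proof (rule typed_apps)
  show "lterm_typed (trans_arity ar) [] (Const f) (arrows (map trans_ty Ts) (trans_ty T))"
    using lterm_typed.Const_typed[of "trans_arity ar" "[]" f] assms(1)
    by (simp add: trans_arity_def)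
  show "list_all2 (lterm_typed (trans_arity ar) []) (map g ts) (map trans_ty Ts)"
    using assms(2) by (simp add: list_all2_map1 list_all2_map2)
qed

lemma typed_ground_trans:
  assumes "nterm_typed ar t T"
  shows "lterm_typed (trans_arity ar) [] (ground_trans t) (trans_ty T)"
  using assms
proof (induction rule: nterm_typed.induct)
  case (fun_typed f Ts T ts)
  then show ?case
    by (auto intro!: typed_Const_apps elim: list_all2_mono)
next
  case (abst_typed t T a)
  then show ?case using typed_lambda[of _ "ground_trans t" _ "atom_var a"] by simp
next
  case (susp_typed p X)
  then show ?case
    using lterm_typed.Free_typed[of "trans_arity ar" "[]" "LVar (UnkName X) (trans_ty (unk_sort X))"]
    by simp
qed (auto intro: typed_atom_var)

lemma typed_trans_nterm:
  assumes "nterm_typed ar t T"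
  shows "lterm_typed (trans_arity ar) [] (trans_nterm as t) (trans_ty T)"
  using assms
proof (induction rule: nterm_typed.induct)
  case (fun_typed f Ts T ts)
  then show ?case
    by (auto intro!: typed_Const_apps elim: list_all2_mono)
next
  case (abst_typed t T a)
  then show ?case using typed_lambda[of _ "trans_nterm as t" _ "atom_var a"] by simp
next
  case (susp_typed p X)
  \<comment> \<open>A well-formed \<open>p\<close> preserves sorts, so each argument has the type
    expected at its position.\<close>
  have "lterm_typed (trans_arity ar) [] (Free (atom_var (perm_atom p a))) (BaseAtom (atom_sort a))"
    for a
    using typed_atom_var[of _ _ "perm_atom p a"] susp_typed by (simp add: atom_sort_perm_atom)
  then show ?case
    using lterm_typed.Free_typed[of "trans_arity ar" "[]" "unk_var as X"]
    by (auto intro!: typed_apps simp: unk_var_def list_all2_map1 list_all2_map2 list_all2_same)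
qed (auto intro: typed_atom_var)

text \<open>The action of \<open>p\<close> as a renaming. An \<open>AtomName\<close> with a type
  other than its sort is a different variable and stays fixed, which keeps the map
  injective.\<close>

definition perm_lvar :: "'n perm \<Rightarrow> ('n, 'd) lvar \<Rightarrow> ('n, 'd) lvar" where
  "perm_lvar p x =
     (case lvar_name x of
        AtomName a \<Rightarrow> if x = atom_var a then atom_var (perm_atom p a) else x
      | UnkName X \<Rightarrow> x)"

lemma perm_lvar_atom_var [simp]: "perm_lvar p (atom_var a) = atom_var (perm_atom p a)"
  by (simp add: perm_lvar_def atom_var_def)

lemma perm_lvar_other: "x \<notin> range atom_var \<Longrightarrow> perm_lvar p x = x"
  by (auto simp: perm_lvar_def split: lname.split)

lemma UnkName_not_atom_var [simp]: "LVar (UnkName X) T \<noteq> atom_var a" "atom_var a \<noteq> LVar (UnkName X) T"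
  by (simp_all add: atom_var_def)

lemma inj_perm_lvar: "inj (perm_lvar p :: ('n, 'd) lvar \<Rightarrow> _)"
proof (rule injI)
  fix x y :: "('n, 'd) lvar"
  assume eq: "perm_lvar p x = perm_lvar p y"
  show "x = y"
  proof (cases "x \<in> range atom_var")
    case True
    with eq show ?thesis
      by (cases "y \<in> range atom_var")
        (auto simp: inj_eq[OF inj_perm_atom] perm_lvar_other)
  next
    case False
    with eq show ?thesis
      by (cases "y \<in> range atom_var") (auto simp: perm_lvar_other)
  qed
qed

text \<open>At suspensions both sides are the same variable, since the reading forgets permutations.
  At abstractions, preservation of sorts makes the annotations of \<open>Lam\<close> agree.\<close>

lemma ground_trans_perm:
  assumes "wf_perm p"
  shows "ground_trans (perm_nterm p t) = lsubst (Free \<circ> perm_lvar p) (ground_trans t)"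
proof (induction t)
  case (NFun f ts)
  then show ?case by (simp add: lsubst_apps comp_def cong: map_cong)
next
  case (NAbst a t)
  then show ?case
    using rename_bind[OF inj_perm_lvar, of p 0 "atom_var a" "ground_trans t"]
      atom_sort_perm_atom[OF assms, of a]
    by (simp add: lambda_def comp_def)
next
  case (NSusp q X)
  then show ?case by (simp add: perm_lvar_def)
qed simp

text \<open>The suspension case holds for any \<open>\<Delta>\<close>, because the reading contains
  no atom variable there.\<close>

lemma fresh_not_free: "fresh \<Delta> a t \<Longrightarrow> atom_var a \<notin> lterm_frees (ground_trans t)"
  by (induction rule: fresh.induct) (auto simp: frees_apps frees_lambda)

inductive_cases typed_NFunE: "nterm_typed ar (NFun f ts) T"
inductive_cases typed_NAbstE: "nterm_typed ar (NAbst a t) T"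

text \<open>\<alpha>-equal readings coincide syntactically in de Bruijn form. The common type forces
  the two bound atoms of an abstraction to have the same sort, so annotations agree and the swapping
  is well-formed.\<close>

lemma napprox_ground_trans:
  assumes "napprox \<Delta> t u" "nterm_typed ar t T" "nterm_typed ar u T"
  shows "ground_trans t = ground_trans u"
  using assms
proof (induction arbitrary: T rule: napprox.induct)
  case (napprox_fun ts us f)
  obtain Ts where "list_all2 (nterm_typed ar) ts Ts" "list_all2 (nterm_typed ar) us Ts"
    using napprox_fun.prems by (auto elim!: typed_NFunE)
  then have "map ground_trans ts = map ground_trans us"
    using napprox_fun.IH by (intro nth_equalityI) (auto simp: list_all2_conv_all_nth)
  then show ?case by simp
next
  case (napprox_abst_same t u a)
  then show ?case by (auto elim!: typed_NAbstE)
next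
  case (napprox_abst_diff a a' t u)
  from napprox_abst_diff.prems obtain U where sort: "atom_sort a = atom_sort a'"
    and t: "nterm_typed ar t U" and u: "nterm_typed ar u U"
    by (auto elim!: typed_NAbstE)
  have wf: "wf_perm [(a, a')]" using sort by (simp add: wf_perm_def)
  have a: "atom_var a \<notin> lterm_frees (ground_trans u)"
    using napprox_abst_diff.hyps(3) by (rule fresh_not_free)
  \<comment> \<open>As \<open>a\<close> is not free in the reading of \<open>u\<close>, the swapping
    acts there as the one-way renaming of \<open>a'\<close> to \<open>a\<close>.\<close>
  have "perm_lvar [(a, a')] z = (if z = atom_var a' then atom_var a else z)"
    if "z \<in> lterm_frees (ground_trans u)" for z
    using that a by (cases "z \<in> range atom_var") (auto simp: perm_lvar_other transpose_def)
  then have "bind 0 (atom_var a) (lsubst (Free \<circ> perm_lvar [(a, a')]) (ground_trans u)) =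
      bind 0 (atom_var a') (ground_trans u)"
    using a by (intro bind_rename) auto
  then show ?case
    using napprox_abst_diff.IH[OF t perm_nterm_typed[OF u wf]] sort
    by (simp add: lambda_def ground_trans_perm[OF wf])
qed auto


section \<open>The higher-order solution\<close>

text \<open>Membership in \<open>V\<close> ensures finite support. The test against
  \<open>unk_var\<close> is there because the same name with another type is a different
  variable.\<close>

definition ho_subst ::
  "'n atom list \<Rightarrow> ('n, 'd, 'f) nsubst \<Rightarrow> ('n, 'd) unk set \<Rightarrow> ('n, 'd, 'f) lsubst" where
  "ho_subst as \<sigma> V x =
     (case lvar_name x of
        AtomName a \<Rightarrow> Free x
      | UnkName X \<Rightarrow>
          if X \<in> V \<and> x = unk_var as X then lambdas (map atom_var as) (ground_trans (\<sigma> X)) else Free x)"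

lemma ho_subst_atom_var [simp]: "ho_subst as \<sigma> V (atom_var a) = Free (atom_var a)"
  by (simp add: ho_subst_def atom_var_def)

lemma ho_subst_unk_var:
  "X \<in> V \<Longrightarrow> ho_subst as \<sigma> V (unk_var as X) = lambdas (map atom_var as) (ground_trans (\<sigma> X))"
  by (simp add: ho_subst_def unk_var_def)

lemma ho_subst_cases:
  obtains "ho_subst as \<sigma> V x = Free x"
  | X where "X \<in> V" "x = unk_var as X"
      "ho_subst as \<sigma> V x = lambdas (map atom_var as) (ground_trans (\<sigma> X))"
proof (cases "\<exists>X \<in> V. x = unk_var as X")
  case True
  then show ?thesis using ho_subst_unk_var that(2) by blast
next
  case False
  then have "ho_subst as \<sigma> V x = Free x" by (auto simp: ho_subst_def split: lname.split)
  then show ?thesis by (rule that(1))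
qed

lemma typed_ho_value:
  assumes "is_nsubst ar \<sigma>"
  shows "lterm_typed (trans_arity ar) [] (lambdas (map atom_var as) (ground_trans (\<sigma> X)))
    (lvar_type (unk_var as X))"
proof -
  have "nterm_typed ar (\<sigma> X) (unk_sort X)"
    using assms by (simp add: is_nsubst_def)
  from typed_lambdas[OF typed_ground_trans[OF this], of "map atom_var as"]
  show ?thesis by (simp add: unk_var_def comp_def)
qed

lemma is_lsubst_ho_subst:
  assumes "is_nsubst ar \<sigma>" "finite V"
  shows "is_lsubst (trans_arity ar) (ho_subst as \<sigma> V)"
proof -
  have "x \<in> unk_var as ` V" if "ho_subst as \<sigma> V x \<noteq> Free x" for x
    using that by (cases rule: ho_subst_cases[of as \<sigma> V x]) auto
  then have "{x. ho_subst as \<sigma> V x \<noteq> Free x} \<subseteq> unk_var as ` V"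
    by auto
  moreover have "lterm_typed (trans_arity ar) [] (ho_subst as \<sigma> V x) (lvar_type x)" for x
    by (cases rule: ho_subst_cases[of as \<sigma> V x])
      (auto intro: typed_ho_value assms(1) lterm_typed.Free_typed)
  ultimately show ?thesis
    using assms(2) by (auto simp: is_lsubst_def intro: finite_subset)
qed

text \<open>The values abstract over all of \<open>as\<close>, so \<open>atom_var a\<close> is not
  free in them and cannot be captured.\<close>

lemma ho_subst_lambda:
  fixes \<sigma> :: "('n, 'd, 'f) nsubst"
  assumes "is_nsubst ar \<sigma>" "a \<in> set as"
  shows "lsubst (ho_subst as \<sigma> V) (lambda (atom_var a) s) =
    lambda (atom_var a) (lsubst (ho_subst as \<sigma> V) s)"
proof (rule lsubst_lambda)
  fix y :: "('n, 'd) lvar" and k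
  assume "y \<noteq> atom_var a"
  moreover have "bind k (atom_var a) (lambdas (map atom_var as) (ground_trans (\<sigma> X))) =
      lambdas (map atom_var as) (ground_trans (\<sigma> X))" for X
    using assms(2) by (intro bind_closed[OF typed_ho_value[OF assms(1)]]) (auto simp: frees_lambdas)
  ultimately show "bind k (atom_var a) (ho_subst as \<sigma> V y) = ho_subst as \<sigma> V y"
    by (cases rule: ho_subst_cases[of as \<sigma> V y]) simp_all
qed simp

text \<open>The list \<open>bs\<close> is kept apart from \<open>as\<close> so that induction can
  shorten it while the substitution stays the same.\<close>

lemma ho_subst_lambdas:
  assumes "is_nsubst ar \<sigma>" "set bs \<subseteq> set as"
  shows "lsubst (ho_subst as \<sigma> V) (lambdas (map atom_var bs) s) =
    lambdas (map atom_var bs) (lsubst (ho_subst as \<sigma> V) s)"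
  using assms(2) by (induction bs) (auto simp: ho_subst_lambda[OF assms(1)])

text \<open>New redexes arise at suspensions, where the abstracted value meets its atom arguments.
  Contracting them renames by \<open>perm_lvar p\<close>, which by \<open>ground_trans_perm\<close>
  is the reading of \<open>perm_nterm p (\<sigma> X)\<close>.\<close>

lemma ho_subst_beta_reds:
  fixes \<sigma> :: "('n, 'd, 'f) nsubst"
  assumes "is_nsubst ar \<sigma>" "nterm_typed ar t T" "nterm_atoms t \<subseteq> set as" "nterm_unks t \<subseteq> V"
  shows "beta_red\<^sup>*\<^sup>* (lsubst (ho_subst as \<sigma> V) (trans_nterm as t)) (ground_trans (nsubst \<sigma> t))"
  using assms(2-)
proof (induction rule: nterm_typed.induct)
  case (fun_typed f Ts T ts)
  then show ?case
    by (auto simp: lsubst_apps list_all2_conv_all_nth UN_subset_iff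
        intro!: beta_reds_apps)
next
  case (atom_typed a)
  then show ?case by simp
next
  case (abst_typed t T a)
  then show ?case by (auto simp: ho_subst_lambda[OF assms(1)] intro: beta_reds_lambda)
next
  case (susp_typed p X)
  let ?xs = "map atom_var as"
  \<comment> \<open>All atoms of \<open>p\<close> lie in \<open>as\<close>, so renaming just the
    abstracted variables already performs the whole permutation.\<close>
  have "(if y \<in> set ?xs then perm_lvar p y else id y) = perm_lvar p y" for y :: "('n, 'd) lvar"
  proof (cases "y \<in> range atom_var")
    case True
    then obtain a where "y = atom_var a" by blast
    moreover have "a \<notin> set as \<Longrightarrow> perm_atom p a = a"
      using susp_typed.prems(1) by (auto intro!: perm_atom_outside)
    ultimately show ?thesis by (cases "a \<in> set as") auto
  next
    case False
    then show ?thesis by (simp add: perm_lvar_other)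
  qed
  then have "beta_red\<^sup>*\<^sup>* (apps (lambdas ?xs (ground_trans (\<sigma> X))) (map (Free \<circ> perm_lvar p) ?xs))
      (lsubst (Free \<circ> perm_lvar p) (ground_trans (\<sigma> X)))"
    using beta_reds_apps_lambdas_rename[of id ?xs "ground_trans (\<sigma> X)" "perm_lvar p"] by simp
  then show ?case
    using susp_typed
    by (simp add: lsubst_apps ho_subst_unk_var ground_trans_perm comp_def)
qed

theorem theorem5p15:
  fixes ar :: "('n, 'd, 'f) arity"
    and P :: "('n, 'd, 'f) nproblem"
    and as :: "'n atom list"
  assumes "is_nproblem ar P"
    and "distinct as" and "set as = nproblem_atoms P"
    and "nsolvable ar P"
  shows "lsolvable (trans_arity ar) (trans_problem as P)"
proof -
  obtain \<Delta> \<sigma> where \<sigma>: "is_nsubst ar \<sigma>"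
    and sol: "\<And>t u. (t, u) \<in> P \<Longrightarrow> napprox \<Delta> (nsubst \<sigma> t) (nsubst \<sigma> u)"
    using assms(4) unfolding nsolvable_def nsolution_def by blast
  define V where "V = (\<Union>(t, u) \<in> P. nterm_unks t \<union> nterm_unks u)"
  let ?\<theta> = "ho_subst as \<sigma> V"
  have "finite V"
    using assms(1) by (auto simp: V_def is_nproblem_def finite_nterm_unks)
  then have \<theta>: "is_lsubst (trans_arity ar) ?\<theta>"
    using \<sigma> by (rule is_lsubst_ho_subst[rotated])
  have "\<exists>U. beta_eta_eq (trans_arity ar) U
      (lsubst ?\<theta> (lambdas (map atom_var as) (trans_nterm as t)))
      (lsubst ?\<theta> (lambdas (map atom_var as) (trans_nterm as u)))" if tu: "(t, u) \<in> P" for t u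
  proof -
    obtain T where t: "nterm_typed ar t T" and u: "nterm_typed ar u T"
      using assms(1) tu by (auto simp: is_nproblem_def)
    have sub: "nterm_atoms t \<subseteq> set as" "nterm_atoms u \<subseteq> set as"
        "nterm_unks t \<subseteq> V" "nterm_unks u \<subseteq> V"
      using tu assms(3) by (auto simp: nproblem_atoms_def V_def)
    \<comment> \<open>The solved nominal equation enters here: both sides will reduce to one and the
      same term.\<close>
    have eq: "ground_trans (nsubst \<sigma> u) = ground_trans (nsubst \<sigma> t)"
      using napprox_ground_trans[OF sol[OF tu] nsubst_typed[OF t \<sigma>] nsubst_typed[OF u \<sigma>]] by simp
    have typed: "lterm_typed (trans_arity ar) []
        (lsubst ?\<theta> (lambdas (map atom_var as) (trans_nterm as s)))
        (arrows (map lvar_type (map atom_var as)) (trans_ty T))" if "nterm_typed ar s T" for s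
      using \<theta> by (intro typed_lsubst typed_lambdas typed_trans_nterm that) (simp add: is_lsubst_def)
    have red: "beta_red\<^sup>*\<^sup>* (lsubst ?\<theta> (lambdas (map atom_var as) (trans_nterm as s)))
        (lambdas (map atom_var as) (ground_trans (nsubst \<sigma> s)))"
      if "nterm_typed ar s T" "nterm_atoms s \<subseteq> set as" "nterm_unks s \<subseteq> V" for s
      using beta_reds_lambdas[OF ho_subst_beta_reds[OF \<sigma> that]]
      by (simp add: ho_subst_lambdas[OF \<sigma>])
    show ?thesis
      using beta_eta_eq_if_joinable[OF typed[OF t] typed[OF u] red[OF t sub(1,3)]]
        red[OF u sub(2,4)] eq by auto
  qed
  then show ?thesis
    using \<theta> unfolding lsolvable_def trans_problem_def by (intro exI[of _ ?\<theta>]) auto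
qed

end
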